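(* Let $A\in\mathbb{R}^{2n\times 2n}$ be a symmetric positive-semidefinite matrix whose kernel is a symplectic subspace of $\mathbb{R}^{2n}$, and let $0\le d_1\le\cdots\le d_n$ be the symplectic eigenvalues of $A$. Then for every integer $k$ with $1\le k\le n$, $$\min_{X\in\mathrm{Sp}(2k,2n)}\mathrm{tr}(X^TAX)=2\sum_{j=1}^k d_j$$ (in particular, the minimum is attained).
   Context: For a positive integer $n$, $J_{2n}=\begin{bmatrix}0&I_n\\-I_n&0\end{bmatrix}\in\mathbb{R}^{2n\times2n}$, where $I_n$ is the $n\times n$ identity matrix. For $1\le k\le n$, $\mathrm{Sp}(2k,2n)=\{X\in\mathbb{R}^{2n\times 2k}: X^TJ_{2n}X=J_{2k}\}$, and $\mathrm{Sp}(2n)=\mathrm{Sp}(2n,2n)$ is the set of symplectic $2n\times 2n$ matrices. A subspace $\mathbb{U}\subset\mathbb{R}^{2n}$ is called symplectic if for every $x\in\mathbb{U}\setminus\{0\}$ there exists $y\in\mathbb{U}$ such that $x^TJ_{2n}y=1$; the trivial subspace $\{0\}$ is symplectic (so positive-definite $A$ are included). If $A\in\mathbb{R}^{2n\times 2n}$ is symmetric positive-semidefinite with symplectic kernel, then there exists $S\in\mathrm{Sp}(2n)$ such that $S^TAS=\begin{bmatrix}D&0\\0&D\end{bmatrix}$ with $D=\mathrm{diag}(d_1,\ldots,d_n)$ and $0\le d_1\le\cdots\le d_n$ (Williamson's diagonal form); the numbers $d_1,\ldots,d_n$ are uniquely determined by $A$ and are called the symplectic eigenvalues of $A$. *)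

theory Defs
  imports "Jordan_Normal_Form.Matrix_Kernel"
begin

definition mat_trace :: "real mat \<Rightarrow> real" where
  "mat_trace A = (\<Sum>i<dim_row A. A $$ (i, i))"

definition pos_semidef_mat :: "nat \<Rightarrow> real mat \<Rightarrow> bool" where
  "pos_semidef_mat m A \<longleftrightarrow>
     A \<in> carrier_mat m m \<and> A\<^sup>T = A \<and> (\<forall>x\<in>carrier_vec m. 0 \<le> x \<bullet> (A *\<^sub>v x))"

text \<open>The index of \<open>symp_J n\<close> is half of the size of the matrix: this is $J_{2n}$.\<close>

definition symp_J :: "nat \<Rightarrow> real mat" where
  "symp_J n = four_block_mat (0\<^sub>m n n) (1\<^sub>m n) (- 1\<^sub>m n) (0\<^sub>m n n)"

text \<open>Likewise, \<open>Sp k n\<close> is $\mathrm{Sp}(2k,2n)$; the group $\mathrm{Sp}(2n)$ is \<open>Sp n n\<close>.\<close>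

definition Sp :: "nat \<Rightarrow> nat \<Rightarrow> real mat set" where
  "Sp k n = {X \<in> carrier_mat (2 * n) (2 * k). X\<^sup>T * symp_J n * X = symp_J k}"

definition symplectic_subspace :: "nat \<Rightarrow> real vec set \<Rightarrow> bool" where
  "symplectic_subspace n U \<longleftrightarrow>
     VectorSpace.subspace class_ring U (module_vec TYPE(real) (2 * n)) \<and>
     (\<forall>x\<in>U - {0\<^sub>v (2 * n)}. \<exists>y\<in>U. x \<bullet> (symp_J n *\<^sub>v y) = 1)"

text \<open>
  \<open>symplectic_eigenvalues n A d\<close>: the numbers $d_1 \le \dots \le d_n$ are the symplectic
  eigenvalues of the $2n \times 2n$ matrix $A$, i.e. the diagonal entries in Williamson's diagonal
  form. This is a relation; by Williamson's theorem such a \<open>d\<close> exists for every positive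
  semidefinite \<open>A\<close> with symplectic kernel, and its values on \<open>{1..n}\<close>, the only ones that
  matter, are determined by \<open>A\<close>. The shift is due to matrices being indexed from 0.
\<close>

definition symplectic_eigenvalues :: "nat \<Rightarrow> real mat \<Rightarrow> (nat \<Rightarrow> real) \<Rightarrow> bool" where
  "symplectic_eigenvalues n A d \<longleftrightarrow>
     (\<forall>j\<in>{1..n}. 0 \<le> d j) \<and> mono_on {1..n} d \<and>
     (\<exists>S\<in>Sp n n. let D = mat_diag n (\<lambda>i. d (Suc i)) in
        S\<^sup>T * A * S = four_block_mat D (0\<^sub>m n n) (0\<^sub>m n n) D)"

end

theory Submission
  imports Defs "Jordan_Normal_Form.Determinant"
begin

text \<open>
  Replacing \<open>X\<close> by \<open>S\<^sup>-\<^sup>1 X\<close>, one may take \<open>A = diag(D, D)\<close>, so that the trace is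
  \<open>\<Sum>i. d i * w i\<close>, where \<open>w i\<close> is the sum of the squared norms of the rows \<open>i\<close> and \<open>n + i\<close> of \<open>X\<close>.
  By Abel summation it is enough to bound each tail \<open>\<Sum>i>m. w i\<close> from below by \<open>2 (k - m)\<close>.
  The first \<open>m\<close> pairs of rows have at least \<open>2 (k - m)\<close> common orthonormal null vectors \<open>e\<close>.
  For each of them \<open>1 = (J e)\<^sup>T (X\<^sup>T J X) e\<close> involves only the remaining rows,
  hence is at most half the sum of the squared norms of the remaining parts of \<open>X e\<close> and \<open>X J e\<close>.
  Summing over the vectors \<open>e\<close>, Bessel's inequality for the orthonormal systems \<open>e\<close> and \<open>J e\<close>
  bounds the result by the tail.
\<close>

section \<open>Orthonormal systems\<close>

definition orthonormal_on :: "nat \<Rightarrow> 'i set \<Rightarrow> ('i \<Rightarrow> real vec) \<Rightarrow> bool" where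
  "orthonormal_on q I e \<longleftrightarrow> (\<forall>a\<in>I. e a \<in> carrier_vec q) \<and>
     (\<forall>a\<in>I. \<forall>b\<in>I. e a \<bullet> e b = (if a = b then 1 else 0))"

text \<open>Induction on the index set: removing from \<open>r\<close> its component along the new
  vector \<open>e t\<close> keeps the products with the other vectors and lowers the squared norm by
  exactly \<open>(r \<bullet> e t)\<^sup>2\<close>.\<close>

lemma bessel_inequality:
  assumes "finite I" "orthonormal_on q I e" "r \<in> carrier_vec q"
  shows "(\<Sum>a\<in>I. (r \<bullet> e a)\<^sup>2) \<le> r \<bullet> r"
  using assms
proof (induction I arbitrary: r rule: finite_induct)
  case empty
  then show ?case
    by (auto simp: scalar_prod_def intro!: sum_nonneg)
next
  case (insert t I)
  have on: "orthonormal_on q I e" and et: "e t \<in> carrier_vec q" "e t \<bullet> e t = 1"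
    and ea: "\<And>a. a \<in> I \<Longrightarrow> e a \<in> carrier_vec q \<and> e t \<bullet> e a = 0"
    using insert.prems(1) insert.hyps by (auto simp: orthonormal_on_def)
  define c where "c = r \<bullet> e t"
  define r' where "r' = r - c \<cdot>\<^sub>v e t"
  have r: "r \<in> carrier_vec q" and r': "r' \<in> carrier_vec q"
    using insert.prems et by (auto simp: r'_def)
  have "r' \<bullet> e a = r \<bullet> e a" if "a \<in> I" for a
    using ea[OF that] r et by (simp add: r'_def minus_scalar_prod_distrib[of _ q])
  moreover have "r' \<bullet> r' = r \<bullet> r - c\<^sup>2"
  proof -
    have "r' \<bullet> r' = r \<bullet> r' - c * (e t \<bullet> r')"
      using r r' et by (subst r'_def, subst minus_scalar_prod_distrib[of _ q]) auto
    also have "r \<bullet> r' = r \<bullet> r - c * c"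
      using r et by (simp add: r'_def scalar_prod_minus_distrib[of _ q] c_def)
    also have "e t \<bullet> r' = 0"
      using r et comm_scalar_prod[of "e t" q r]
      by (simp add: r'_def scalar_prod_minus_distrib[of _ q] c_def)
    finally show ?thesis by (simp add: power2_eq_square)
  qed
  ultimately show ?case
    using insert.IH[OF on r'] insert.hyps by (simp add: c_def)
qed

text \<open>Fewer equations than unknowns have a nonzero solution: padded with zero rows, the system
  becomes square with determinant zero.\<close>

lemma exists_common_null_vec:
  fixes f :: "nat \<Rightarrow> 'a :: idom vec"
  assumes "p < q" and f: "\<And>i. i < p \<Longrightarrow> f i \<in> carrier_vec q"
  shows "\<exists>v\<in>carrier_vec q. v \<noteq> 0\<^sub>v q \<and> (\<forall>i<p. f i \<bullet> v = 0)"
proof -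
  define c where "c i = (if i < p then f i else 0\<^sub>v q)" for i
  \<comment> \<open>Row \<open>p\<close> is spelled out as zero, in the shape that
    \<open>det_row_0\<close> expects; it exists because \<open>p < q\<close>. The zero default in
    \<open>c\<close> makes every other row a vector of length \<open>q\<close>.\<close>
  define B where "B = mat\<^sub>r q q (\<lambda>i. if i = p then 0\<^sub>v q else c i)"
  have B: "B \<in> carrier_mat q q"
    by (simp add: B_def)
  have "det B = 0"
    unfolding B_def using assms(1) f by (intro det_row_0) (auto simp: c_def)
  then obtain v where v: "v \<in> carrier_vec q" "v \<noteq> 0\<^sub>v q" "B *\<^sub>v v = 0\<^sub>v q"
    using det_0_iff_vec_prod_zero[OF B] by auto
  have "f i \<bullet> v = 0" if i: "i < p" for i
  proof -
    have "row B i = f i"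
      using f[OF i] i assms(1) by (simp add: B_def c_def)
    then have "f i \<bullet> v = (B *\<^sub>v v) $ i"
      using B i assms(1) by simp
    then show ?thesis
      using v i assms(1) by simp
  qed
  then show ?thesis
    using v by blast
qed

text \<open>The vectors already found are added to the constraints, so the next null vector is
  orthogonal to them without any projection and only has to be normalised.\<close>

lemma exists_orthonormal_null_vecs:
  fixes f :: "nat \<Rightarrow> real vec"
  assumes f: "\<And>i. i < p \<Longrightarrow> f i \<in> carrier_vec q" and "p + s \<le> q"
  shows "\<exists>e. orthonormal_on q {..<s} e \<and> (\<forall>a<s. \<forall>i<p. f i \<bullet> e a = 0)"
  using assms(2)
proof (induction s)
  case 0
  show ?case by (simp add: orthonormal_on_def)
next
  case (Suc s)
  then obtain e where e: "orthonormal_on q {..<s} e" "\<forall>a<s. \<forall>i<p. f i \<bullet> e a = 0"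
    by auto
  have ec: "e a \<in> carrier_vec q" if "a < s" for a
    using e that by (auto simp: orthonormal_on_def)
  define g where "g i = (if i < p then f i else e (i - p))" for i
  have "\<exists>v\<in>carrier_vec q. v \<noteq> 0\<^sub>v q \<and> (\<forall>i<p + s. g i \<bullet> v = 0)"
    using Suc.prems f ec by (intro exists_common_null_vec) (auto simp: g_def)
  then obtain v where v: "v \<in> carrier_vec q" "v \<noteq> 0\<^sub>v q"
    and gv: "\<And>i. i < p + s \<Longrightarrow> g i \<bullet> v = 0"
    by blast
  have fv: "f i \<bullet> v = 0" if "i < p" for i
    using gv[of i] that by (simp add: g_def)
  have ev: "e a \<bullet> v = 0" "v \<bullet> e a = 0" if "a < s" for a
    using gv[of "p + a"] that ec[OF that] v comm_scalar_prod[of v q "e a"] by (auto simp: g_def)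
  have vv: "0 < v \<bullet> v"
    using conjugate_square_greater_0_vec[OF v(1)] v(2) by simp
  define u where "u = (1 / sqrt (v \<bullet> v)) \<cdot>\<^sub>v v"
  have u: "u \<in> carrier_vec q" "u \<bullet> u = 1"
    using v vv by (auto simp: u_def field_simps)
  have "orthonormal_on q {..<Suc s} (e(s := u))"
    using e u v ev ec by (auto simp: orthonormal_on_def less_Suc_eq u_def)
  moreover have "\<forall>a<Suc s. \<forall>i<p. f i \<bullet> (e(s := u)) a = 0"
    using e fv f v by (auto simp: less_Suc_eq u_def)
  ultimately show ?case
    by blast
qed

section \<open>Sums and congruences\<close>

lemma sum_lessThan_add:
  fixes f :: "nat \<Rightarrow> 'a :: comm_monoid_add"
  shows "(\<Sum>i<m + n. f i) = (\<Sum>i<m. f i) + (\<Sum>i<n. f (m + i))"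
  by (induction n) (simp_all add: add.assoc)

lemma sum_lessThan_double:
  fixes f :: "nat \<Rightarrow> 'a :: comm_monoid_add"
  shows "(\<Sum>i<2 * n. f i) = (\<Sum>i<n. f i + f (n + i))"
  by (simp add: mult_2 sum_lessThan_add sum.distrib)

lemma sum_mult_nonneg_if_tails_nonneg:
  fixes d c :: "nat \<Rightarrow> 'a :: linordered_idom"
  assumes nonneg: "\<And>i. i < n \<Longrightarrow> 0 \<le> d i" and mono: "\<And>i. Suc i < n \<Longrightarrow> d i \<le> d (Suc i)"
    and tail: "\<And>m. m < n \<Longrightarrow> 0 \<le> (\<Sum>i=m..<n. c i)"
  shows "0 \<le> (\<Sum>i<n. d i * c i)"
proof -
  \<comment> \<open>Abel summation as a downward induction on \<open>m\<close>: the nonnegative tail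
    allows \<open>d m\<close> to be raised to \<open>d (Suc m)\<close>. For \<open>Suc m = n\<close>
    that tail is empty, so nothing about \<open>d n\<close> is required.\<close>
  have "d m * (\<Sum>i=m..<n. c i) \<le> (\<Sum>i=m..<n. d i * c i)" if "m \<le> n" for m
    using that
  proof (induction m rule: inc_induct)
    case base
    show ?case by simp
  next
    case (step m)
    have "d m * (\<Sum>i=Suc m..<n. c i) \<le> d (Suc m) * (\<Sum>i=Suc m..<n. c i)"
    proof (cases "Suc m < n")
      case True
      then show ?thesis
        using mono tail by (intro mult_right_mono) auto
    qed simp
    with step show ?case
      by (simp add: sum.atLeast_Suc_lessThan distrib_left)
  qed
  from this[of 0] show ?thesis
    using mult_nonneg_nonneg[OF nonneg[of 0] tail[of 0]]
    by (cases "n = 0") (auto simp: atLeast0LessThan)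
qed

lemma index_congruence:
  assumes "M \<in> carrier_mat p p" "X \<in> carrier_mat p q" "i < q" "j < q"
  shows "(X\<^sup>T * M * X) $$ (i, j) = col X i \<bullet> (M *\<^sub>v col X j)"
proof -
  have "(X\<^sup>T * M * X) $$ (i, j) = (X\<^sup>T * (M * X)) $$ (i, j)"
    using assms by (subst assoc_mult_mat[of _ q p _ p _ q]) auto
  also have "\<dots> = col X i \<bullet> (M *\<^sub>v col X j)"
    using assms by (simp add: mult_mat_vec_def)
  finally show ?thesis .
qed

lemma congruence_mult:
  fixes M :: "'a :: comm_semiring_0 mat"
  assumes "M \<in> carrier_mat p p" "S \<in> carrier_mat p p" "Y \<in> carrier_mat p q"
  shows "(S * Y)\<^sup>T * M * (S * Y) = Y\<^sup>T * (S\<^sup>T * M * S) * Y"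
proof -
  have "(S * Y)\<^sup>T = Y\<^sup>T * S\<^sup>T"
    using assms by (simp add: transpose_mult[of _ p p _ q])
  moreover have "Y\<^sup>T * S\<^sup>T * M * (S * Y) = Y\<^sup>T * S\<^sup>T * M * S * Y"
    using assms by (intro assoc_mult_mat[symmetric, of _ q p _ p _ q]) (auto simp: mult_carrier_mat[of _ q p])
  ultimately have "(S * Y)\<^sup>T * M * (S * Y) = Y\<^sup>T * S\<^sup>T * M * S * Y"
    by simp
  also have "Y\<^sup>T * S\<^sup>T * M * S = Y\<^sup>T * (S\<^sup>T * M * S)"
    using assms by (simp add: assoc_mult_mat[of _ q p _ p _ p] mult_carrier_mat[of _ p p])
  finally show ?thesis .
qed

text \<open>The trace runs over the columns of \<open>Y\<close>; exchanging the two sums collects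
  the squares by rows, to which the weights \<open>l i\<close> belong.\<close>

lemma trace_congruence_diag:
  assumes "Y \<in> carrier_mat p q"
  shows "mat_trace (Y\<^sup>T * mat_diag p l * Y) = (\<Sum>i<p. l i * (row Y i \<bullet> row Y i))"
proof -
  have "col Y j \<bullet> (mat_diag p l *\<^sub>v col Y j) = (\<Sum>i<p. l i * (Y $$ (i, j))\<^sup>2)" if j: "j < q" for j
  proof -
    have "(mat_diag p l *\<^sub>v col Y j) $ i = l i * Y $$ (i, j)" if i: "i < p" for i
    proof -
      have "(mat_diag p l *\<^sub>v col Y j) $ i = (mat_diag p l * Y) $$ (i, j)"
        using assms i j by (simp add: mat_diag_def)
      then show ?thesis
        using assms i j by (simp add: mat_diag_mult_left[OF assms])
    qed
    then show ?thesis
      using assms j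
      by (auto simp: scalar_prod_def power2_eq_square atLeast0LessThan mat_diag_def ac_simps
          simp del: index_mult_mat_vec intro!: sum.cong)
  qed
  then have "mat_trace (Y\<^sup>T * mat_diag p l * Y) = (\<Sum>j<q. \<Sum>i<p. l i * (Y $$ (i, j))\<^sup>2)"
    using assms by (auto simp: mat_trace_def index_congruence[of _ p _ q]
        simp del: index_mult_mat(1) intro!: sum.cong)
  also have "\<dots> = (\<Sum>i<p. \<Sum>j<q. l i * (Y $$ (i, j))\<^sup>2)"
    by (rule sum.swap)
  also have "\<dots> = (\<Sum>i<p. l i * (row Y i \<bullet> row Y i))"
    using assms by (auto simp: scalar_prod_def power2_eq_square atLeast0LessThan sum_distrib_left
        intro!: sum.cong)
  finally show ?thesis .
qed

section \<open>The symplectic form\<close>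

lemma symp_J_carrier [simp]: "symp_J n \<in> carrier_mat (2 * n) (2 * n)"
  by (auto simp: symp_J_def mult_2)

lemma dim_symp_J [simp]: "dim_row (symp_J n) = 2 * n" "dim_col (symp_J n) = 2 * n"
  by (rule carrier_matD[OF symp_J_carrier])+

lemma index_symp_J:
  assumes "i < 2 * n" "j < 2 * n"
  shows "symp_J n $$ (i, j) = (if j = n + i then 1 else if i = n + j then - 1 else 0)"
proof -
  have "symp_J n $$ (i, j) = (if i < n then if j < n then 0\<^sub>m n n $$ (i, j) else 1\<^sub>m n $$ (i, j - n)
      else if j < n then (- 1\<^sub>m n) $$ (i - n, j) else 0\<^sub>m n n $$ (i - n, j - n))"
    using assms unfolding symp_J_def by (subst index_mat_four_block) simp_all
  then show ?thesis
    using assms by auto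
qed

lemma symp_J_mult_vec:
  assumes "y \<in> carrier_vec (2 * n)"
  shows "symp_J n *\<^sub>v y = vec (2 * n) (\<lambda>i. if i < n then y $ (n + i) else - y $ (i - n))"
proof (rule eq_vecI)
  fix i assume i: "i < dim_vec (vec (2 * n) (\<lambda>i. if i < n then y $ (n + i) else - y $ (i - n)))"
  have "(symp_J n *\<^sub>v y) $ i = (\<Sum>j<2 * n. symp_J n $$ (i, j) * y $ j)"
    using assms i by (auto simp: scalar_prod_def atLeast0LessThan)
  also have "\<dots> = (\<Sum>j<2 * n. if j = (if i < n then n + i else i - n)
      then (if i < n then y $ j else - y $ j) else 0)"
    by (rule sum.cong) (use i in \<open>auto simp: index_symp_J\<close>)
  also have "\<dots> = (if i < n then y $ (n + i) else - y $ (i - n))"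
    using i by (subst sum.delta) auto
  finally show "(symp_J n *\<^sub>v y) $ i
      = vec (2 * n) (\<lambda>i. if i < n then y $ (n + i) else - y $ (i - n)) $ i"
    using i by simp
qed simp

lemma symp_J_mult_vec_carrier [simp]: "symp_J n *\<^sub>v y \<in> carrier_vec (2 * n)"
  by (rule carrier_vecI) simp

lemma scalar_prod_symp_J:
  assumes "x \<in> carrier_vec (2 * n)" "y \<in> carrier_vec (2 * n)"
  shows "x \<bullet> (symp_J n *\<^sub>v y) = (\<Sum>i<n. x $ i * y $ (n + i) - x $ (n + i) * y $ i)"
proof -
  have "x \<bullet> (symp_J n *\<^sub>v y) = (\<Sum>i<2 * n. x $ i * (symp_J n *\<^sub>v y) $ i)"
    using symp_J_mult_vec_carrier[of n y] unfolding scalar_prod_def atLeast0LessThan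
    by (simp only: carrier_vecD)
  then show ?thesis
    using assms by (simp add: sum_lessThan_double symp_J_mult_vec)
qed

text \<open>\<open>symp_J n\<close> only permutes coordinates up to sign, so it is orthogonal and
  maps orthonormal systems to orthonormal systems.\<close>

lemma scalar_prod_symp_J_symp_J:
  assumes "x \<in> carrier_vec (2 * n)" "y \<in> carrier_vec (2 * n)"
  shows "(symp_J n *\<^sub>v x) \<bullet> (symp_J n *\<^sub>v y) = x \<bullet> y"
proof -
  have "x \<bullet> y = (\<Sum>i<2 * n. x $ i * y $ i)"
    using assms by (simp add: scalar_prod_def atLeast0LessThan)
  then show ?thesis
    using assms by (auto simp: scalar_prod_symp_J sum_lessThan_double symp_J_mult_vec[of x]
        intro: sum.cong)
qed

lemma symp_J_square: "symp_J n * symp_J n = - 1\<^sub>m (2 * n)"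
proof -
  have "symp_J n * symp_J n = four_block_mat (- 1\<^sub>m n) (0\<^sub>m n n) (0\<^sub>m n n) (- 1\<^sub>m n)"
    unfolding symp_J_def by (subst mult_four_block_mat[of _ n n _ n _ n _ _ n _ n])
      (simp_all, auto)
  also have "\<dots> = - 1\<^sub>m (2 * n)"
    by (rule eq_matI) auto
  finally show ?thesis .
qed

lemma Sp_invertible:
  assumes "S \<in> Sp n n"
  obtains T where "T \<in> carrier_mat (2 * n) (2 * n)" "S * T = 1\<^sub>m (2 * n)"
proof -
  let ?J = "symp_J n"
  have S: "S \<in> carrier_mat (2 * n) (2 * n)" and SJS: "S\<^sup>T * ?J * S = ?J"
    using assms by (auto simp: Sp_def)
  \<comment> \<open>From \<open>S\<^sup>T * ?J * S = ?J\<close> and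
    \<open>?J * ?J = - 1\<^sub>m (2 * n)\<close>, this is a left inverse of \<open>S\<close>, hence
    also a right inverse.\<close>
  define T where "T = - (?J * (S\<^sup>T * ?J))"
  have T: "T \<in> carrier_mat (2 * n) (2 * n)"
    using S by (simp add: T_def mult_carrier_mat[of _ _ "2 * n"])
  have "T * S = - (?J * (S\<^sup>T * ?J) * S)"
    using S unfolding T_def by (intro uminus_mult_left_mat) simp
  also have "?J * (S\<^sup>T * ?J) * S = ?J * (S\<^sup>T * ?J * S)"
    using S by (intro assoc_mult_mat[of _ "2 * n" "2 * n" _ "2 * n" _ "2 * n"])
      (simp_all add: mult_carrier_mat[of _ _ "2 * n"])
  also have "\<dots> = - 1\<^sub>m (2 * n)"
    by (simp add: SJS symp_J_square)
  finally have "T * S = 1\<^sub>m (2 * n)"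
    by simp
  then have "S * T = 1\<^sub>m (2 * n)"
    by (rule mat_mult_left_right_inverse[OF T S])
  with T show thesis
    by (rule that)
qed

text \<open>The difference is taken in the reals, so for \<open>m > k\<close> the bound is negative
  and holds trivially.\<close>

lemma Sp_tail_rows_norm_ge:
  assumes Y: "Y \<in> Sp k n" and "m \<le> n"
  shows "2 * (real k - real m)
    \<le> (\<Sum>i=m..<n. row Y i \<bullet> row Y i + row Y (n + i) \<bullet> row Y (n + i))"
proof -
  have Yc: "Y \<in> carrier_mat (2 * n) (2 * k)" and YJ: "Y\<^sup>T * symp_J n * Y = symp_J k"
    using Y by (auto simp: Sp_def)
  have rc: "row Y i \<in> carrier_vec (2 * k)" for i
    using Yc by (intro carrier_vecI) auto
  show ?thesis
  proof (cases "m \<le> k")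
    case False
    have "0 \<le> (\<Sum>i=m..<n. row Y i \<bullet> row Y i + row Y (n + i) \<bullet> row Y (n + i))"
      by (intro sum_nonneg add_nonneg_nonneg) (auto simp: scalar_prod_def intro!: sum_nonneg)
    then show ?thesis
      using False by simp
  next
    case True
    \<comment> \<open>The \<open>2 * m\<close> leading rows, listed by \<open>f\<close>, constrain
      vectors of length \<open>2 * k\<close>, which leaves room for this many orthonormal null
      vectors.\<close>
    define s where "s = 2 * (k - m)"
    define f where "f i = row Y (if i < m then i else n + (i - m))" for i
    obtain e where e: "orthonormal_on (2 * k) {..<s} e"
      and fe: "\<And>a i. a < s \<Longrightarrow> i < 2 * m \<Longrightarrow> f i \<bullet> e a = 0"
    proof -
      have "2 * m + s \<le> 2 * k"
        using True by (simp add: s_def)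
      moreover have "f i \<in> carrier_vec (2 * k)" for i
        by (simp add: f_def rc)
      ultimately show thesis
        using exists_orthonormal_null_vecs[of "2 * m" f "2 * k" s] that by blast
    qed
    define e' where "e' a = symp_J k *\<^sub>v e a" for a
    have ec: "e a \<in> carrier_vec (2 * k)" and ee: "e a \<bullet> e a = 1" if "a < s" for a
      using e that by (auto simp: orthonormal_on_def)
    have e': "orthonormal_on (2 * k) {..<s} e'"
      using e by (auto simp: orthonormal_on_def e'_def scalar_prod_symp_J_symp_J)
    have e'c: "e' a \<in> carrier_vec (2 * k)" for a
      by (simp add: e'_def)
    have null: "row Y i \<bullet> e a = 0" "row Y (n + i) \<bullet> e a = 0" if "a < s" "i < m" for a i
      using fe[OF that(1), of i] fe[OF that(1), of "m + i"] that by (auto simp: f_def)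
    have bound: "2 \<le> (\<Sum>i=m..<n. ((row Y i \<bullet> e a)\<^sup>2 + (row Y i \<bullet> e' a)\<^sup>2)
        + ((row Y (n + i) \<bullet> e a)\<^sup>2 + (row Y (n + i) \<bullet> e' a)\<^sup>2))" (is "2 \<le> ?R") if a: "a < s" for a
    proof -
      \<comment> \<open>The norm of \<open>e' a\<close> is written as a value of the form
        \<open>symp_J k\<close>, which is then replaced by \<open>Y\<^sup>T * symp_J n * Y\<close>
        and expressed through the rows of \<open>Y\<close>.\<close>
      have "1 = e' a \<bullet> (symp_J k *\<^sub>v e a)"
        using scalar_prod_symp_J_symp_J[OF ec[OF a] ec[OF a]] ee[OF a] by (simp add: e'_def)
      also have "symp_J k *\<^sub>v e a = Y\<^sup>T *\<^sub>v (symp_J n *\<^sub>v (Y *\<^sub>v e a))"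
      proof -
        have "symp_J k *\<^sub>v e a = (Y\<^sup>T * symp_J n) *\<^sub>v (Y *\<^sub>v e a)"
          unfolding YJ[symmetric] using Yc ec[OF a]
          by (intro assoc_mult_mat_vec[of _ "2 * k" "2 * n" _ "2 * k"])
            (simp_all add: mult_carrier_mat[of _ _ "2 * n"])
        also have "\<dots> = Y\<^sup>T *\<^sub>v (symp_J n *\<^sub>v (Y *\<^sub>v e a))"
          using Yc ec[OF a] by (intro assoc_mult_mat_vec[of _ "2 * k" "2 * n" _ "2 * n"]) auto
        finally show ?thesis .
      qed
      also have "e' a \<bullet> \<dots> = (Y *\<^sub>v e' a) \<bullet> (symp_J n *\<^sub>v (Y *\<^sub>v e a))"
        using Yc e'c[of a]
        by (metis transpose_vec_mult_scalar comm_scalar_prod symp_J_mult_vec_carrier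
            mult_mat_vec_carrier transpose_carrier_mat)
      also have "\<dots> = (\<Sum>i<n. (row Y i \<bullet> e' a) * (row Y (n + i) \<bullet> e a)
          - (row Y (n + i) \<bullet> e' a) * (row Y i \<bullet> e a))"
        using Yc ec[OF a] e'c[of a] by (subst scalar_prod_symp_J) auto
      \<comment> \<open>Only \<open>e a\<close> is annihilated by the leading rows, not
        \<open>e' a\<close>; but each product has a factor with \<open>e a\<close>, so all terms
        below \<open>m\<close> vanish.\<close>
      also have "\<dots> = (\<Sum>i=m..<n. (row Y i \<bullet> e' a) * (row Y (n + i) \<bullet> e a)
          - (row Y (n + i) \<bullet> e' a) * (row Y i \<bullet> e a))"
        using null[OF a] by (intro sum.mono_neutral_right) auto
      finally have eq: "1 = \<dots>" .
      \<comment> \<open>The right side minus the left side is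
        \<open>(p - v)\<^sup>2 + (q + u)\<^sup>2\<close>.\<close>
      have ineq: "2 * (p * v - q * u) \<le> (u\<^sup>2 + p\<^sup>2) + (v\<^sup>2 + q\<^sup>2)" for p q u v :: real
        using zero_le_power2[of "p - v"] zero_le_power2[of "q + u"]
        by (simp add: power2_eq_square algebra_simps)
      have "2 * 1 \<le> ?R"
        unfolding eq sum_distrib_left by (intro sum_mono ineq)
      then show ?thesis by simp
    qed
    have "2 * real s = (\<Sum>a<s. 2)"
      by simp
    also have "\<dots> \<le> (\<Sum>a<s. \<Sum>i=m..<n. ((row Y i \<bullet> e a)\<^sup>2 + (row Y i \<bullet> e' a)\<^sup>2)
        + ((row Y (n + i) \<bullet> e a)\<^sup>2 + (row Y (n + i) \<bullet> e' a)\<^sup>2))"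
      by (intro sum_mono bound) simp
    also have "\<dots> = (\<Sum>i=m..<n. ((\<Sum>a<s. (row Y i \<bullet> e a)\<^sup>2) + (\<Sum>a<s. (row Y i \<bullet> e' a)\<^sup>2))
        + ((\<Sum>a<s. (row Y (n + i) \<bullet> e a)\<^sup>2) + (\<Sum>a<s. (row Y (n + i) \<bullet> e' a)\<^sup>2)))"
      by (subst sum.swap) (simp add: sum.distrib)
    \<comment> \<open>Bessel is applied to \<open>e\<close> and to \<open>e'\<close> separately, as
      the two systems need not be orthogonal to each other. Each row norm is thus counted twice,
      which matches \<open>2 * s = 4 * (k - m)\<close> on the left.\<close>
    also have "\<dots> \<le> (\<Sum>i=m..<n. (row Y i \<bullet> row Y i + row Y i \<bullet> row Y i)
        + (row Y (n + i) \<bullet> row Y (n + i) + row Y (n + i) \<bullet> row Y (n + i)))"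
      by (intro sum_mono add_mono bessel_inequality[OF _ e rc] bessel_inequality[OF _ e' rc]) auto
    also have "\<dots> = 2 * (\<Sum>i=m..<n. row Y i \<bullet> row Y i + row Y (n + i) \<bullet> row Y (n + i))"
      by (simp add: sum_distrib_left distrib_left)
    finally show ?thesis
      using True by (simp add: s_def of_nat_diff)
  qed
qed

section \<open>The trace minimum\<close>

text \<open>Brings Williamson's block form into the shape of \<open>trace_congruence_diag\<close>;
  rows \<open>i\<close> and \<open>n + i\<close> share one weight.\<close>

lemma diag_block_eq_mat_diag:
  "four_block_mat (mat_diag n l) (0\<^sub>m n n) (0\<^sub>m n n) (mat_diag n l)
    = mat_diag (2 * n) (\<lambda>i. l (if i < n then i else i - n))"
  by (rule eq_matI) (auto simp: mat_diag_def)

lemma Sp_trace_diag_ge: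
  assumes Y: "Y \<in> Sp k n" and "k \<le> n"
    and nonneg: "\<And>i. i < n \<Longrightarrow> 0 \<le> l i" and mono: "\<And>i. Suc i < n \<Longrightarrow> l i \<le> l (Suc i)"
  shows "2 * (\<Sum>i<k. l i)
    \<le> mat_trace (Y\<^sup>T * mat_diag (2 * n) (\<lambda>i. l (if i < n then i else i - n)) * Y)"
proof -
  define w where "w i = row Y i \<bullet> row Y i + row Y (n + i) \<bullet> row Y (n + i)" for i
  \<comment> \<open>The excess of the row weights over those of the expected minimiser, which has
    weight 2 on the first \<open>k\<close> pairs of rows and 0 on the others.\<close>
  define c where "c i = w i - (if i < k then 2 else 0)" for i
  have "0 \<le> (\<Sum>i=m..<n. c i)" if "m < n" for m
  proof -
    have "(\<Sum>i=m..<n. if i < k then 2 else 0 :: real) = (\<Sum>i=m..<k. 2)"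
      using \<open>k \<le> n\<close> by (intro sum.mono_neutral_cong_right) auto
    then have "(\<Sum>i=m..<n. c i) = (\<Sum>i=m..<n. w i) - 2 * real (k - m)"
      by (simp add: c_def sum_subtractf)
    moreover have "0 \<le> (\<Sum>i=m..<n. w i)"
      by (intro sum_nonneg) (auto simp: w_def scalar_prod_def intro!: add_nonneg_nonneg sum_nonneg)
    \<comment> \<open>For \<open>m \<le> k\<close> the tail bound applies; beyond \<open>k\<close>
      nothing is subtracted and the weights themselves are nonnegative.\<close>
    ultimately show ?thesis
      using Sp_tail_rows_norm_ge[OF Y, of m] that
      by (cases "m \<le> k") (auto simp: w_def of_nat_diff)
  qed
  then have "0 \<le> (\<Sum>i<n. l i * c i)"
    using nonneg mono by (intro sum_mult_nonneg_if_tails_nonneg)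
  also have "(\<Sum>i<n. l i * c i) = (\<Sum>i<n. l i * w i) - (\<Sum>i<n. if i < k then 2 * l i else 0)"
    unfolding sum_subtractf[symmetric] by (intro sum.cong) (auto simp: c_def algebra_simps)
  also have "(\<Sum>i<n. if i < k then 2 * l i else 0) = (\<Sum>i<k. 2 * l i)"
    using \<open>k \<le> n\<close> by (intro sum.mono_neutral_cong_right) auto
  finally have "2 * (\<Sum>i<k. l i) \<le> (\<Sum>i<n. l i * w i)"
    by (simp add: sum_distrib_left)
  also have "\<dots> = mat_trace (Y\<^sup>T * mat_diag (2 * n) (\<lambda>i. l (if i < n then i else i - n)) * Y)"
    using Y by (subst trace_congruence_diag[of _ _ "2 * k"])
      (auto simp: Sp_def sum_lessThan_double w_def distrib_left)
  finally show ?thesis .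
qed

theorem theorem3p1:
  fixes n k :: nat and A :: "real mat" and d :: "nat \<Rightarrow> real"
  assumes "pos_semidef_mat (2 * n) A"
    and "symplectic_subspace n (mat_kernel A)"
    and "symplectic_eigenvalues n A d"
    and "1 \<le> k" and "k \<le> n"
  shows "(\<exists>X\<in>Sp k n. mat_trace (X\<^sup>T * A * X) = 2 * (\<Sum>j=1..k. d j)) \<and>
         (\<forall>X\<in>Sp k n. 2 * (\<Sum>j=1..k. d j) \<le> mat_trace (X\<^sup>T * A * X))"
proof -
  define l where "l i = d (Suc i)" for i
  define L where "L = mat_diag (2 * n) (\<lambda>i. l (if i < n then i else i - n))"
  have A: "A \<in> carrier_mat (2 * n) (2 * n)"
    using assms(1) by (simp add: pos_semidef_mat_def)
  obtain S where S: "S \<in> Sp n n" and SAS: "S\<^sup>T * A * S = L"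
    using assms(3) unfolding symplectic_eigenvalues_def Let_def L_def l_def
    by (auto simp: diag_block_eq_mat_diag)
  have Sc: "S \<in> carrier_mat (2 * n) (2 * n)" and SJS: "S\<^sup>T * symp_J n * S = symp_J n"
    using S by (auto simp: Sp_def)
  have l0: "0 \<le> l i" if "i < n" for i
    using assms(3) that by (auto simp: symplectic_eigenvalues_def l_def)
  have lmono: "l i \<le> l (Suc i)" if "Suc i < n" for i
    using assms(3) that by (auto simp: symplectic_eigenvalues_def l_def intro: mono_onD)
  have sum_l: "(\<Sum>j=1..k. d j) = (\<Sum>i<k. l i)"
    unfolding l_def
    by (rule sum.reindex_bij_witness[of _ Suc "\<lambda>j. j - 1"]) auto
  \<comment> \<open>The minimiser \<open>X\<close> consists of columns \<open>j\<close> and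
    \<open>n + j\<close> of \<open>S\<close> for \<open>j < k\<close>, the symplectic pairs
    belonging to the \<open>k\<close> smallest eigenvalues; \<open>\<phi>\<close> gives their
    positions.\<close>
  define \<phi> where "\<phi> j = (if j < k then j else n + (j - k))" for j
  define X where "X = mat (2 * n) (2 * k) (\<lambda>(i, j). S $$ (i, \<phi> j))"
  have \<phi>: "\<phi> j < 2 * n" if "j < 2 * k" for j
    using that \<open>k \<le> n\<close> by (auto simp: \<phi>_def)
  have Xc: "X \<in> carrier_mat (2 * n) (2 * k)"
    by (simp add: X_def)
  have colX: "col X j = col S (\<phi> j)" if "j < 2 * k" for j
    using that Sc \<phi> by (auto simp: X_def)
  \<comment> \<open>A congruence by \<open>X\<close> is a submatrix of the congruence by
    \<open>S\<close>. With \<open>M = symp_J n\<close> this makes \<open>X\<close> symplectic, with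
    \<open>M = A\<close> it gives the trace.\<close>
  have entry: "(X\<^sup>T * M * X) $$ (i, j) = (S\<^sup>T * M * S) $$ (\<phi> i, \<phi> j)"
    if "M \<in> carrier_mat (2 * n) (2 * n)" "i < 2 * k" "j < 2 * k" for M i j
    using index_congruence[OF that(1) Xc that(2,3)]
      index_congruence[OF that(1) Sc \<phi>[OF that(2)] \<phi>[OF that(3)]] colX that(2,3)
    by metis
  have "X\<^sup>T * symp_J n * X = symp_J k"
  proof (rule eq_matI)
    fix i j assume "i < dim_row (symp_J k)" "j < dim_col (symp_J k)"
    then have ij: "i < 2 * k" "j < 2 * k"
      by auto
    then show "(X\<^sup>T * symp_J n * X) $$ (i, j) = symp_J k $$ (i, j)"
      using entry[OF symp_J_carrier ij] \<phi>[OF ij(1)] \<phi>[OF ij(2)] \<open>k \<le> n\<close> unfolding SJS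
      by (auto simp: symp_J_def \<phi>_def)
  qed (use Xc in auto)
  then have "X \<in> Sp k n"
    using Xc by (simp add: Sp_def)
  moreover have "mat_trace (X\<^sup>T * A * X) = (\<Sum>i<2 * k. L $$ (\<phi> i, \<phi> i))"
    using Xc entry[OF A] by (auto simp: mat_trace_def SAS simp del: index_mult_mat(1) intro!: sum.cong)
  moreover have "\<dots> = 2 * (\<Sum>i<k. l i)"
    unfolding sum_lessThan_double sum_distrib_left
    using \<open>k \<le> n\<close> by (intro sum.cong) (auto simp: L_def mat_diag_def \<phi>_def)
  moreover have "2 * (\<Sum>i<k. l i) \<le> mat_trace (X\<^sup>T * A * X)" if X: "X \<in> Sp k n" for X
  proof -
    have Xc: "X \<in> carrier_mat (2 * n) (2 * k)" and XJX: "X\<^sup>T * symp_J n * X = symp_J k"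
      using X by (auto simp: Sp_def)
    obtain T where T: "T \<in> carrier_mat (2 * n) (2 * n)" "S * T = 1\<^sub>m (2 * n)"
      using Sp_invertible[OF S] .
    \<comment> \<open>This is \<open>S\<^sup>-\<^sup>1 X\<close>. Since \<open>S\<close> preserves
      the form, \<open>Y\<close> is again in \<open>Sp k n\<close>, while \<open>A\<close> turns
      into the diagonal matrix \<open>L\<close>.\<close>
    define Y where "Y = T * X"
    have Yc: "Y \<in> carrier_mat (2 * n) (2 * k)"
      using T Xc by (simp add: Y_def)
    have SY: "S * Y = X"
      using assoc_mult_mat[OF Sc T(1) Xc] T Xc by (simp add: Y_def)
    have "Y \<in> Sp k n"
      using congruence_mult[OF symp_J_carrier Sc Yc] Yc XJX by (simp add: Sp_def SY SJS)
    moreover have "X\<^sup>T * A * X = Y\<^sup>T * L * Y"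
      using congruence_mult[OF A Sc Yc] by (simp add: SY SAS)
    ultimately show ?thesis
      using Sp_trace_diag_ge[of Y k n l] \<open>k \<le> n\<close> l0 lmono by (simp add: L_def)
  qed
  ultimately show ?thesis
    unfolding sum_l by auto
qed

end
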